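(* Let $A$ be a C$^*$-algebra with cancellation. Suppose that $A$ is contained in the closure (in norm) of the group $M(A)^{-1}$ of invertible elements of the multiplier algebra $M(A)$, and that $K_0(A)^+=D_0(A)$. Then for all $a,b\in A$ and all $g,h\in K_0(A)^+$, \[ s_{g+h}(a+b)\leq s_g(a)+s_h(b). \]
   Context: For a C$^*$-algebra $A$, $P(A)$ denotes the set of projections of $A$, $K_0(A)$ is the usual $K_0$-group with positive cone $K_0(A)^+=\{[p]_0 : p \text{ a projection in } M_n(A) \text{ for some } n\geq 1\}$, and for $g,h\in K_0(A)$ we write $g\leq h$ if $h-g\in K_0(A)^+$. The dimension range is $D_0(A)=\{[p]_0\mid p\in P(A)\}$. $A$ has cancellation if for all projections $p,q$ in $\bigcup_{n\geq1}M_n(A)$, $[p]_0=[q]_0$ if and only if $p$ and $q$ are Murray--von Neumann equivalent. The singular value function of $a\in A$ is the function $s(a)\colon K_0(A)^+\to[0,\infty)$ defined by \[ s_g(a):=\inf\{\|a-ap\| \mid p\in P(A),\ [p]_0\leq g\},\qquad g\in K_0(A)^+. \] *)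

theory Defs
  imports "HOL-Analysis.Analysis"
begin

locale cstar_algebra =
  fixes sc :: "complex \<Rightarrow> 'a::{real_normed_algebra,banach} \<Rightarrow> 'a"
    and st :: "'a \<Rightarrow> 'a"
  assumes sc_of_real: "\<And>r x. sc (complex_of_real r) x = scaleR r x"
    and sc_mult: "\<And>z w x. sc (z * w) x = sc z (sc w x)"
    and sc_add_left: "\<And>z w x. sc (z + w) x = sc z x + sc w x"
    and sc_add_right: "\<And>z x y. sc z (x + y) = sc z x + sc z y"
    and sc_mult_left: "\<And>z x y. sc z (x * y) = sc z x * y"
    and sc_mult_right: "\<And>z x y. sc z (x * y) = x * sc z y"
    and sc_norm: "\<And>z x. norm (sc z x) = cmod z * norm x"
    and st_st: "\<And>x. st (st x) = x"
    and st_add: "\<And>x y. st (x + y) = st x + st y"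
    and st_mult: "\<And>x y. st (x * y) = st y * st x"
    and st_sc: "\<And>z x. st (sc z x) = sc (cnj z) (st x)"
    and cstar_id: "\<And>x. norm (st x * x) = (norm x)\<^sup>2"

definition cproj :: "('a::real_normed_algebra \<Rightarrow> 'a) \<Rightarrow> 'a \<Rightarrow> bool" where
  "cproj st p \<longleftrightarrow> st p = p \<and> p * p = p"

text \<open>The unitization is A \<times> complex, with (a,l)(b,m) = (ab + l b + m a, l m).\<close>
definition umult :: "(complex \<Rightarrow> 'a \<Rightarrow> 'a) \<Rightarrow> ('a::real_normed_algebra \<times> complex)
     \<Rightarrow> ('a \<times> complex) \<Rightarrow> ('a \<times> complex)" where
  "umult sc x y = (fst x * fst y + sc (snd x) (fst y) + sc (snd y) (fst x), snd x * snd y)"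

definition ustar :: "('a \<Rightarrow> 'a) \<Rightarrow> ('a \<times> complex) \<Rightarrow> ('a \<times> complex)" where
  "ustar st x = (st (fst x), cnj (snd x))"

text \<open>Matrices over the unitization are modelled as infinite matrices
(nat \<Rightarrow> nat \<Rightarrow> entry); an element of M_n is one supported in the n\<times>n corner.
Matrices with entries in A are those with all scalar parts 0.\<close>
type_synonym 'a umat = "nat \<Rightarrow> nat \<Rightarrow> 'a \<times> complex"

definition supp_in :: "nat \<Rightarrow> ('a::zero) umat \<Rightarrow> bool" where
  "supp_in n M \<longleftrightarrow> (\<forall>i j. n \<le> i \<or> n \<le> j \<longrightarrow> M i j = 0)"

definition in_A :: "'a umat \<Rightarrow> bool" where
  "in_A M \<longleftrightarrow> (\<forall>i j. snd (M i j) = 0)"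

definition umm :: "(complex \<Rightarrow> 'a \<Rightarrow> 'a) \<Rightarrow> nat \<Rightarrow> ('a::real_normed_algebra) umat \<Rightarrow> 'a umat \<Rightarrow> 'a umat" where
  "umm sc N M P = (\<lambda>i j. \<Sum>k<N. umult sc (M i k) (P k j))"

definition ustar_m :: "('a \<Rightarrow> 'a) \<Rightarrow> 'a umat \<Rightarrow> 'a umat" where
  "ustar_m st M = (\<lambda>i j. ustar st (M j i))"

definition uproj :: "(complex \<Rightarrow> 'a \<Rightarrow> 'a) \<Rightarrow> ('a \<Rightarrow> 'a) \<Rightarrow> nat \<Rightarrow> ('a::real_normed_algebra) umat \<Rightarrow> bool" where
  "uproj sc st n p \<longleftrightarrow> supp_in n p \<and> ustar_m st p = p \<and> umm sc n p p = p"

definition proj_A :: "(complex \<Rightarrow> 'a \<Rightarrow> 'a) \<Rightarrow> ('a \<Rightarrow> 'a) \<Rightarrow> nat \<Rightarrow> ('a::real_normed_algebra) umat \<Rightarrow> bool" where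
  "proj_A sc st n p \<longleftrightarrow> uproj sc st n p \<and> in_A p"

text \<open>Murray--von Neumann equivalence ~0 of projections in M_infty (partial isometry v
of any (rectangular) finite size, embedded in a square corner), over the unitization
and over A.\<close>
definition mvn :: "(complex \<Rightarrow> 'a \<Rightarrow> 'a) \<Rightarrow> ('a \<Rightarrow> 'a) \<Rightarrow> ('a::real_normed_algebra) umat \<Rightarrow> 'a umat \<Rightarrow> bool" where
  "mvn sc st p q \<longleftrightarrow> (\<exists>N v. supp_in N v \<and> supp_in N p \<and> supp_in N q \<and>
      umm sc N (ustar_m st v) v = p \<and> umm sc N v (ustar_m st v) = q)"

definition mvn_A :: "(complex \<Rightarrow> 'a \<Rightarrow> 'a) \<Rightarrow> ('a \<Rightarrow> 'a) \<Rightarrow> ('a::real_normed_algebra) umat \<Rightarrow> 'a umat \<Rightarrow> bool" where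
  "mvn_A sc st p q \<longleftrightarrow> (\<exists>N v. in_A v \<and> supp_in N v \<and> supp_in N p \<and> supp_in N q \<and>
      umm sc N (ustar_m st v) v = p \<and> umm sc N v (ustar_m st v) = q)"

definition dsum :: "nat \<Rightarrow> ('a::zero) umat \<Rightarrow> 'a umat \<Rightarrow> 'a umat" where
  "dsum n p q = (\<lambda>i j. if i < n \<and> j < n then p i j
                       else if n \<le> i \<and> n \<le> j then q (i - n) (j - n) else 0)"

text \<open>Classes [p]_0 are represented by sized projections (n,p).  For projections p,q over A,
[p]_0 = [q]_0 in K_0(A) means equality of their classes in the Grothendieck group
K_0 of the unitization (K_0(A) being the kernel of K_0(unitization) \<rightarrow> K_0(C)), i.e.
p \<oplus> r ~0 q \<oplus> r for some projection r over the unitization.\<close>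
definition k0_eq :: "(complex \<Rightarrow> 'a \<Rightarrow> 'a) \<Rightarrow> ('a \<Rightarrow> 'a) \<Rightarrow> nat \<times> ('a::real_normed_algebra) umat
     \<Rightarrow> nat \<times> 'a umat \<Rightarrow> bool" where
  "k0_eq sc st x y \<longleftrightarrow> (\<exists>k r. uproj sc st k r \<and>
      mvn sc st (dsum (fst x) (snd x) r) (dsum (fst y) (snd y) r))"

definition k0_add :: "nat \<times> ('a::zero) umat \<Rightarrow> nat \<times> 'a umat \<Rightarrow> nat \<times> 'a umat" where
  "k0_add x y = (fst x + fst y, dsum (fst x) (snd x) (snd y))"

text \<open>[p]_0 \<le> [q]_0 iff [q]_0 - [p]_0 \<in> K_0(A)^+, i.e. [q]_0 = [p]_0 + [e]_0 for some
projection e over A.\<close>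
definition k0_le :: "(complex \<Rightarrow> 'a \<Rightarrow> 'a) \<Rightarrow> ('a \<Rightarrow> 'a) \<Rightarrow> nat \<times> ('a::real_normed_algebra) umat
     \<Rightarrow> nat \<times> 'a umat \<Rightarrow> bool" where
  "k0_le sc st x y \<longleftrightarrow> (\<exists>k e. proj_A sc st k e \<and> k0_eq sc st y (k0_add x (k, e)))"

definition single :: "'a::zero \<Rightarrow> 'a umat" where
  "single a = (\<lambda>i j. if i = 0 \<and> j = 0 then (a, 0) else 0)"

definition sval :: "(complex \<Rightarrow> 'a \<Rightarrow> 'a) \<Rightarrow> ('a \<Rightarrow> 'a) \<Rightarrow> nat \<times> ('a::real_normed_algebra) umat
     \<Rightarrow> 'a \<Rightarrow> real" where
  "sval sc st g a = Inf {norm (a - a * p) | p. cproj st p \<and> k0_le sc st (1, single p) g}"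

definition double_centralizer :: "('a::real_normed_algebra \<Rightarrow> 'a) \<Rightarrow> ('a \<Rightarrow> 'a) \<Rightarrow> bool" where
  "double_centralizer L R \<longleftrightarrow>
     (\<forall>a b. L (a * b) = L a * b \<and> R (a * b) = a * R b \<and> R a * b = a * L b)"

text \<open>Invertible multipliers: product (L,R)(L',R') = (L o L', R' o R), unit (id,id).\<close>
definition mult_invertible :: "('a::real_normed_algebra \<Rightarrow> 'a) \<Rightarrow> ('a \<Rightarrow> 'a) \<Rightarrow> bool" where
  "mult_invertible L R \<longleftrightarrow> double_centralizer L R \<and>
     (\<exists>L' R'. double_centralizer L' R' \<and> L \<circ> L' = id \<and> L' \<circ> L = id \<and>
              R' \<circ> R = id \<and> R \<circ> R' = id)"

text \<open>A is contained in the norm closure of M(A)^{-1}; A embeds as (left mult, right mult)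
and the norm of a multiplier (L,R) is the operator norm of L.\<close>
definition in_closure_invertible_multipliers :: "'a::real_normed_algebra itself \<Rightarrow> bool" where
  "in_closure_invertible_multipliers _ \<longleftrightarrow>
     (\<forall>(a::'a) \<epsilon>. \<epsilon> > 0 \<longrightarrow> (\<exists>L R. mult_invertible L R \<and> onorm (\<lambda>b. a * b - L b) < \<epsilon>))"

end

theory Submission
  imports Defs
begin

text \<open>
Let p and q be projections with [p] \<le> g and [q] \<le> h such that a p and b q nearly realize the two
singular values. Since K_0(A)^+ = D_0(A) and A has cancellation, p \<oplus> q is equivalent to a projection f
of A, and a partial isometry implementing this equivalence factors a p + b q as s f t with s, t in A.
Approximate t by an invertible multiplier T. The right support projection e of f T lies in A and is
equivalent to f, so [e] = [p] + [q] \<le> g + h, while s f T (1 - e) = 0 and hence (a p + b q)(1 - e)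
is small.

The polar decomposition of f T is obtained from square roots alone, without spectral theory.
\<close>

text \<open>Invertibility of T is what keeps e inside A: f T has the right inverse T^-1 f, so f T T*
  f is invertible in the corner f A f and the polar decomposition of f T stays in A. The support
  projection of an arbitrary t would in general exist only in the bidual. Since A may lack a unit,
  \<open>f\<close> serves as the unit of its corner, and elsewhere 1 - y occurs only through
  products such as b - y * b. Cancellation turns equalities in K_0, which is defined through the
  unitization, into partial isometries over A that can be multiplied with \<open>a\<close> and
  \<open>b\<close>.\<close>

context cstar_algebra
begin

section \<open>Square roots and contractions\<close>

lemma st_scaleR: "st (r *\<^sub>R x) = r *\<^sub>R st x"
  using st_sc[of "complex_of_real r" x] by (simp add: sc_of_real)

lemma st_zero: "st 0 = 0"
  using st_add[of 0 0] by simp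

lemma st_minus: "st (- x) = - st x"
  using st_add[of x "- x"] by (simp add: st_zero eq_neg_iff_add_eq_0 add.commute)

lemma st_diff: "st (x - y) = st x - st y"
  using st_add[of x "- y"] by (simp add: st_minus)

lemmas st_simps = st_add st_diff st_minus st_zero st_scaleR st_mult st_st

lemma norm_st: "norm (st x) = norm x"
proof -
  have le: "norm x \<le> norm (st x)" for x
  proof (cases "x = 0")
    case False
    have "norm x * norm x \<le> norm (st x) * norm x"
      using norm_mult_ineq[of "st x" x] by (simp add: cstar_id power2_eq_square)
    with False show ?thesis by simp
  qed (simp add: st_zero)
  show ?thesis using le[of x] le[of "st x"] by (simp add: st_st)
qed

lemma norm_mult_st: "norm (x * st x) = (norm x)\<^sup>2"
  using cstar_id[of "st x"] by (simp add: st_st norm_st)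

lemma norm_selfadj_square: "st x = x \<Longrightarrow> norm (x * x) = (norm x)\<^sup>2"
  using cstar_id[of x] by simp

lemma bounded_linear_st: "bounded_linear st"
  by (rule bounded_linear_intro[where K = 1]) (simp_all add: st_add st_scaleR norm_st)

lemma mult_st_eq_0: "x * st x = 0 \<Longrightarrow> x = 0"
  using norm_mult_st[of x] by simp

lemma selfadj_square_eq_0: "st x = x \<Longrightarrow> x * x = 0 \<Longrightarrow> x = 0"
  using mult_st_eq_0[of x] by simp

lemma eq_if_left_mult_eq:
  fixes x y :: 'a
  assumes "\<And>a. a * x = a * y"
  shows "x = y"
proof -
  have "norm (st (x - y) * (x - y)) = 0"
    using assms[of "st (x - y)"] by (simp add: algebra_simps)
  then show ?thesis by (simp add: cstar_id)
qed

text \<open>By the C*-identity \<open>b = st x\<close> is a sufficient test element; it stands in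
  for \<open>b = 1\<close> when there is no unit.\<close>

lemma norm_le_if_left_mult_le:
  fixes x :: 'a
  assumes "\<And>b. norm (x * b) \<le> K * norm b" "0 \<le> K"
  shows "norm x \<le> K"
proof (cases "x = 0")
  case False
  have "norm x * norm x \<le> K * norm x"
    using assms(1)[of "st x"] by (simp add: norm_mult_st norm_st power2_eq_square)
  with False show ?thesis by simp
qed (use assms in simp)

text \<open>With c = b - b * e one has c * st c = c * st b, so the C*-identity bounds |c|^2 by |c|
  |b|.\<close>

lemma norm_proj_complement:
  assumes "cproj st e"
  shows "norm (b - b * e) \<le> norm b"
proof (cases "b - b * e = 0")
  case False
  have e: "st e = e" "e * e = e" using assms by (auto simp: cproj_def)
  have ee: "x * e * e = x * e" for x using e by (simp add: mult.assoc)
  have "(b - b * e) * st (b - b * e) = (b - b * e) * st b"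
    by (simp add: st_simps e algebra_simps ee flip: mult.assoc)
  then have "norm (b - b * e) * norm (b - b * e) \<le> norm (b - b * e) * norm b"
    using norm_mult_st[of "b - b * e"] norm_mult_ineq[of "b - b * e" "st b"]
    by (simp add: norm_st power2_eq_square)
  with False show ?thesis by simp
qed simp

lemma norm_proj_le_1:
  assumes "cproj st f"
  shows "norm f \<le> 1"
proof (cases "f = 0")
  case False
  have "norm f * norm f = norm f"
    using assms norm_selfadj_square[of f] by (simp add: cproj_def power2_eq_square)
  with False show ?thesis by simp
qed simp

text \<open>The element y is 1 - sqrt(1 - x), obtained as the limit of the iteration y' = (x + y^2)/2;
its increments are dominated by those of the scalar iteration for x = 1.\<close>
lemma one_minus_sqrt:
  assumes sa: "st x = x" and nx: "norm x \<le> 1"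
  obtains y where "st y = y" "norm y \<le> 1" "2 *\<^sub>R y - y * y = x"
    "\<And>c. c * x = x * c \<Longrightarrow> c * y = y * c" "\<And>f. f * x = x \<Longrightarrow> f * y = y"
    "\<And>f. x * f = x \<Longrightarrow> y * f = y"
proof -
  define r :: "nat \<Rightarrow> real" where "r = rec_nat 0 (\<lambda>_ t. (1 + t\<^sup>2) / 2)"
  have r: "r 0 = 0" "r (Suc n) = (1 + (r n)\<^sup>2) / 2" for n by (simp_all add: r_def)
  have r01: "0 \<le> r n \<and> r n \<le> 1" for n
    by (induction n) (auto simp: r power_le_one)
  have rinc: "r n \<le> r (Suc n)" for n
    using zero_le_power2[of "r n - 1"] by (simp add: r power2_eq_square algebra_simps)
  define Y :: "nat \<Rightarrow> 'a" where "Y = rec_nat 0 (\<lambda>_ t. (1/2) *\<^sub>R (x + t * t))"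
  have Y: "Y 0 = 0" "Y (Suc n) = (1/2) *\<^sub>R (x + Y n * Y n)" for n by (simp_all add: Y_def)
  have nY: "norm (Y n) \<le> r n" for n
  proof (induction n)
    case (Suc n)
    have "norm (x + Y n * Y n) \<le> 1 + r n * r n"
      by (intro order_trans[OF norm_triangle_ineq] add_mono nx order_trans[OF norm_mult_ineq]
          mult_mono Suc) (use r01 in auto)
    then show ?case by (simp add: Y r power2_eq_square)
  qed (simp add: Y r)
  have dY: "norm (Y (Suc n) - Y n) \<le> r (Suc n) - r n" for n
  proof (induction n)
    case 0
    show ?case using nx by (simp add: Y r)
  next
    case (Suc n)
    have "Y (Suc (Suc n)) - Y (Suc n) =
      (1/2) *\<^sub>R ((Y (Suc n) - Y n) * Y (Suc n) + Y n * (Y (Suc n) - Y n))"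
      by (subst Y(2), subst (3) Y(2)) (simp add: algebra_simps)
    moreover have "norm ((Y (Suc n) - Y n) * Y (Suc n) + Y n * (Y (Suc n) - Y n))
       \<le> (r (Suc n) - r n) * r (Suc n) + r n * (r (Suc n) - r n)"
      by (intro order_trans[OF norm_triangle_ineq] add_mono order_trans[OF norm_mult_ineq]
          mult_mono Suc nY) (use r01 rinc[of n] in auto)
    moreover have "(r (Suc n) - r n) * r (Suc n) + r n * (r (Suc n) - r n)
        = 2 * (r (Suc (Suc n)) - r (Suc n))"
      by (subst r(2)[of "Suc n"], subst (4) r(2)) (simp add: algebra_simps power2_eq_square)
    ultimately show ?case by simp
  qed
  have "convergent r"
    by (rule Bseq_mono_convergent[OF BseqI'[where K = 1]]) (use r01 in auto, use rinc in \<open>simp add: lift_Suc_mono_le\<close>)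
  then have "summable (\<lambda>n. r (Suc n) - r n)"
    by (auto simp: convergent_def intro: telescope_summable)
  then have "summable (\<lambda>n. Y (Suc n) - Y n)"
    by (rule summable_comparison_test'[where N = 0]) (use dY in auto)
  then have "convergent (\<lambda>n. \<Sum>k<n. Y (Suc k) - Y k)"
    by (simp add: summable_iff_convergent)
  then obtain y where lim: "Y \<longlonglongrightarrow> y"
    unfolding sum_lessThan_telescope by (auto simp: Y(1) convergent_def)
  have "(\<lambda>n. Y (Suc n)) \<longlonglongrightarrow> (1/2) *\<^sub>R (x + y * y)"
    unfolding Y by (intro tendsto_intros lim)
  then have yfix: "y = (1/2) *\<^sub>R (x + y * y)"
    using LIMSEQ_unique LIMSEQ_Suc[OF lim] by blast
  show thesis
  proof
    \<comment> \<open>Self-adjointness, commutation and absorption of \<open>f\<close> hold for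
      every iterate, a polynomial in \<open>x\<close> without constant term, and pass to the
      limit.\<close>
    have "st (Y n) = Y n" for n by (induction n) (simp_all add: Y st_simps sa)
    then show "st y = y"
      using LIMSEQ_unique[OF bounded_linear.tendsto[OF bounded_linear_st lim]] lim by simp
    show "norm y \<le> 1"
      by (rule Lim_bounded[OF tendsto_norm[OF lim], of 0]) (use nY r01 order_trans in blast)
    show "2 *\<^sub>R y - y * y = x"
      by (subst (1) yfix) simp
    show "c * y = y * c" if c: "c * x = x * c" for c
    proof -
      have "c * Y n = Y n * c" for n
        by (induction n) (simp_all add: Y algebra_simps c, metis mult.assoc)
      then show ?thesis
        using LIMSEQ_unique[OF tendsto_mult[OF tendsto_const lim, of c]]
          tendsto_mult[OF lim tendsto_const, of c] by simp
    qed
    show "f * y = y" if f: "f * x = x" for f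
    proof -
      have "f * Y n = Y n" for n
        by (induction n) (simp_all add: Y algebra_simps f, metis mult.assoc)
      then show ?thesis
        using LIMSEQ_unique[OF tendsto_mult[OF tendsto_const lim, of f]] lim by simp
    qed
    show "y * f = y" if f: "x * f = x" for f
    proof -
      have "Y n * f = Y n" for n
        by (induction n) (simp_all add: Y algebra_simps f)
      then show ?thesis
        using LIMSEQ_unique[OF tendsto_mult[OF lim tendsto_const, of f]] lim by simp
    qed
  qed
qed

lemma sc_0_left: "sc 0 x = 0"
  using sc_of_real[of 0 x] by simp

lemma sc_minus_left: "sc (- z) x = - sc z x"
  using sc_add_left[of z "- z" x] by (simp add: sc_0_left eq_neg_iff_add_eq_0 add.commute)

lemma sc_minus_right: "sc z (- x) = - sc z x"
  using sc_add_right[of z x "- x"] sc_add_right[of z 0 0]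
  by (simp add: eq_neg_iff_add_eq_0 add.commute)

lemma sc_diff_right: "sc z (x - y) = sc z x - sc z y"
  using sc_add_right[of z x "- y"] by (simp add: sc_minus_right)

lemma sc_i_sc_i: "sc \<i> (sc \<i> x) = - x"
  using sc_mult[of \<i> \<i> x] sc_of_real[of "-1" x] by simp

lemma st_sc_i: "st (sc \<i> x) = - sc \<i> (st x)"
  by (simp add: st_sc sc_minus_left)

lemmas sc_i_simps = sc_i_sc_i st_sc_i sc_add_right sc_diff_right sc_minus_right
  sc_mult_left[symmetric] sc_mult_right[symmetric]

text \<open>With c = sqrt(1 - h^2) the multiplier h + ic is unitary, so c is a contraction.\<close>
lemma norm_one_minus_square_mult_le:
  assumes h: "st h = h" and nh: "norm h \<le> 1"
  shows "norm (b - h * h * b) \<le> norm b"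
proof -
  have nhh: "norm (h * h) \<le> 1" using norm_mult_ineq[of h h] nh
    by (simp add: norm_selfadj_square h power_le_one)
  obtain y where y: "st y = y" "2 *\<^sub>R y - y * y = h * h" "h * y = y * h"
    by (rule one_minus_sqrt[of "h * h"]) (use nhh in \<open>auto simp: st_simps h mult.assoc\<close>)
  have hh: "h * (h * b) = y * b + y * b - y * (y * b)" for b
    using arg_cong[OF y(2), of "\<lambda>u. u * b"] by (simp add: algebra_simps scaleR_2)
  have hy: "h * (y * b) = y * (h * b)" for b by (metis y(3) mult.assoc)
  have c: "norm (b - y * b) \<le> norm b" for b
  proof -
    define d where "d = b - y * b"
    \<comment> \<open>\<open>U\<close> and \<open>V\<close> are the unitary h + ic and its adjoint
      applied to \<open>b\<close>, and \<open>d\<close> is c applied to \<open>b\<close>.\<close>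
    define U where "U = h * b + sc \<i> d"
    define V where "V = h * b - sc \<i> d"
    have "st U * U = st b * b" "st V * V = st b * b"
      by (simp_all add: U_def V_def d_def st_simps sc_i_simps algebra_simps h y hh hy)
    then have "norm U = norm b" "norm V = norm b"
      using cstar_id[of U] cstar_id[of V] cstar_id[of b] by simp_all
    moreover have "norm (U - V) = 2 * norm d"
      by (simp add: U_def V_def sc_norm flip: scaleR_2)
    ultimately have "2 * norm d \<le> norm b + norm b"
      using norm_triangle_ineq4[of U V] by simp
    then show ?thesis by (simp add: d_def)
  qed
  \<comment> \<open>1 - h^2 is the square of c = 1 - y, so the contraction c is applied
    twice.\<close>
  have "b - h * h * b = (b - y * b) - y * (b - y * b)"
    by (simp add: algebra_simps hh)
  then show ?thesis using c[of b] c[of "b - y * b"] by (metis order_trans)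
qed

section \<open>Positivity and polar decomposition\<close>

text \<open>A norm characterization of positivity which makes sums of positive elements positive
at once, stated without reference to a unit.\<close>
definition npos :: "'a \<Rightarrow> bool" where
  "npos x \<longleftrightarrow> (\<exists>M\<ge>0. \<forall>b. norm (M *\<^sub>R b - x * b) \<le> M * norm b)"

lemma npos_add:
  assumes "npos x" "npos y"
  shows "npos (x + y)"
proof -
  obtain M N where M: "M \<ge> 0" "\<And>b. norm (M *\<^sub>R b - x * b) \<le> M * norm b"
    and N: "N \<ge> 0" "\<And>b. norm (N *\<^sub>R b - y * b) \<le> N * norm b"
    using assms by (auto simp: npos_def)
  have "norm ((M + N) *\<^sub>R b - (x + y) * b) \<le> (M + N) * norm b" for b
  proof -
    have "(M + N) *\<^sub>R b - (x + y) * b = (M *\<^sub>R b - x * b) + (N *\<^sub>R b - y * b)"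
      by (simp add: algebra_simps)
    then show ?thesis
      using norm_triangle_ineq[of "M *\<^sub>R b - x * b" "N *\<^sub>R b - y * b"] M(2)[of b] N(2)[of b]
      by (simp add: algebra_simps)
  qed
  then show ?thesis unfolding npos_def using M N by (intro exI[of _ "M + N"]) auto
qed

lemma npos_square:
  assumes h: "st h = h"
  shows "npos (h * h)"
proof (cases "h = 0")
  case True
  then show ?thesis unfolding npos_def by (intro exI[of _ 0]) simp
next
  case False
  define M where "M = (norm h)\<^sup>2"
  have M: "M > 0" using False by (simp add: M_def)
  define k where "k = (1 / norm h) *\<^sub>R h"
  have k: "st k = k" "norm k \<le> 1" using h False by (simp_all add: k_def st_simps)
  have kk: "k * k = (1 / M) *\<^sub>R (h * h)"
    by (simp add: k_def M_def power2_eq_square)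
  have "norm (M *\<^sub>R b - h * h * b) \<le> M * norm b" for b
  proof -
    have "M *\<^sub>R b - h * h * b = M *\<^sub>R (b - k * k * b)"
      using M by (simp add: kk algebra_simps)
    then show ?thesis
      using norm_one_minus_square_mult_le[OF k, of b] M by simp
  qed
  then show ?thesis unfolding npos_def using M by (intro exI[of _ M]) auto
qed

text \<open>The norm bound makes f + x^2 / M a contraction, so f minus it has a self-adjoint square
  root; rescaling gives D that commutes with x and satisfies D^2 = - x^2. Then x + iD times its
  adjoint is x^2 + D^2 = 0, so both x + iD and x - iD vanish.\<close>

lemma selfadj_eq_0_if_npos_minus_square:
  assumes f: "cproj st f" and x: "st x = x" "f * x = x" "x * f = x"
    and neg: "npos (- (x * x))"
  shows "x = 0"
proof -
  have ff: "st f = f" "f * f = f" using f by (auto simp: cproj_def)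
  obtain M0 where M0: "M0 \<ge> 0" "\<And>b. norm (M0 *\<^sub>R b + x * x * b) \<le> M0 * norm b"
    using neg by (auto simp: npos_def)
  define M where "M = M0 + 1"
  have M: "M > 0" using M0 by (simp add: M_def)
  have "norm (M *\<^sub>R f + x * x) \<le> M"
  proof -
    have "M *\<^sub>R f + x * x = (M0 *\<^sub>R f + x * x * f) + f"
      by (simp add: M_def algebra_simps x)
    then have "norm (M *\<^sub>R f + x * x) \<le> M0 * norm f + norm f"
      using norm_triangle_ineq[of "M0 *\<^sub>R f + x * x * f" f] M0(2)[of f] by simp
    also have "\<dots> \<le> M"
      using norm_proj_le_1[OF f] mult_left_mono[of "norm f" 1 M] M by (simp add: M_def algebra_simps)
    finally show ?thesis .
  qed
  define X where "X = f + (1 / M) *\<^sub>R (x * x)"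
  have "X = (1 / M) *\<^sub>R (M *\<^sub>R f + x * x)" using M by (simp add: X_def algebra_simps)
  then have nX: "norm X \<le> 1"
    using \<open>norm (M *\<^sub>R f + x * x) \<le> M\<close> M by simp
  have stX: "st X = X" by (simp add: X_def st_simps ff x)
  have fX: "f * X = X" "X * f = X"
    by (simp_all add: X_def algebra_simps ff x, metis x(2) mult.assoc)
  have xX: "x * X = X * x"
    by (simp add: X_def algebra_simps x)
  obtain y where y: "st y = y" "2 *\<^sub>R y - y * y = X" "x * y = y * x" "f * y = y" "y * f = y"
    by (rule one_minus_sqrt[OF stX nX]) (use fX xX in blast)
  define D where "D = sqrt M *\<^sub>R (f - y)"
  have "D * D = M *\<^sub>R (f - X)"
    using M by (simp add: D_def algebra_simps y ff scaleR_2 flip: y(2))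
  then have DD: "D * D = - (x * x)" using M by (simp add: X_def)
  have stD: "st D = D" by (simp add: D_def st_simps y ff)
  have xD: "x * D = D * x" by (simp add: D_def algebra_simps x y)
  have "(x + sc \<i> D) * st (x + sc \<i> D) = 0"
    by (simp add: st_simps sc_i_simps algebra_simps x(1) stD DD xD)
  then have *: "x + sc \<i> D = 0" by (rule mult_st_eq_0)
  moreover have "x - sc \<i> D = 0"
    using arg_cong[OF *, of st] by (simp add: st_simps st_sc_i x(1) stD)
  ultimately have "2 *\<^sub>R x = 0" by (simp add: scaleR_2)
  then show ?thesis by simp
qed

text \<open>Writing k = a + ib with self-adjoint a and b gives k k* + k* k = 2(a^2 + b^2).\<close>
lemma npos_mult_st_add_st_mult: "npos (k * st k + st k * k)"
proof -
  \<comment> \<open>With this factor \<open>a\<close> and \<open>b\<close> are, up to sign, sqrt 2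
    times the real and imaginary parts of \<open>k\<close>, which absorbs the 2 in the
    identity.\<close>
  define s :: real where "s = sqrt (1/2)"
  have s: "s * s = 1/2" by (simp add: s_def flip: power2_eq_square)
  define a where "a = s *\<^sub>R (k + st k)"
  define b where "b = s *\<^sub>R sc \<i> (k - st k)"
  have "st a = a" "st b = b"
    by (simp_all add: a_def b_def st_simps sc_i_simps add.commute)
  moreover have "k * st k + st k * k = a * a + b * b"
  proof -
    have A: "2 *\<^sub>R (a * a) = (k + st k) * (k + st k)"
      by (simp add: a_def s)
    have "sc \<i> x * sc \<i> x = - (x * x)" for x
      by (simp add: sc_i_sc_i flip: sc_mult_left sc_mult_right)
    then have B: "2 *\<^sub>R (b * b) = - ((k - st k) * (k - st k))"
      by (simp add: b_def s)
    have "2 *\<^sub>R (a * a + b * b) = 2 *\<^sub>R (k * st k + st k * k)"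
      unfolding scaleR_add_right A B by (simp add: algebra_simps scaleR_2)
    then show ?thesis by simp
  qed
  ultimately show ?thesis by (metis npos_add npos_square)
qed

text \<open>This is the theorem of Kelley and Vaught that k k* is positive. If m denotes the negative part
of h = k k*, then v = m k satisfies v v* = - m^3, and r = m^(3/2) v turns this into a vanishing
sum of squares.\<close>
lemma norm_proj_minus_mult_st_le_1:
  assumes f: "cproj st f" and k: "f * k = k" "norm k \<le> 1"
  shows "norm (f - k * st k) \<le> 1"
proof -
  have ff: "st f = f" "f * f = f" using f by (auto simp: cproj_def)
  define h where "h = k * st k"
  have kf: "st k * f = st k" using arg_cong[OF k(1), of st] by (simp add: st_simps ff)
  have h: "st h = h" "f * h = h" "h * f = h" "norm h \<le> 1"
    using k kf by (auto simp: h_def st_simps norm_mult_st power_le_one mult.assoc)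
      (simp flip: mult.assoc)
  define X where "X = f - h * h"
  have X: "st X = X" "f * X = X" "X * f = X" "h * X = X * h"
    by (simp_all add: X_def st_simps ff h algebra_simps)
      (simp add: h flip: mult.assoc)
  have nX: "norm X \<le> 1"
    using norm_one_minus_square_mult_le[OF h(1,4), of f] norm_proj_le_1[OF f]
    by (simp add: X_def mult.assoc h)
  obtain y where y: "st y = y" "norm y \<le> 1" "2 *\<^sub>R y - y * y = X" "h * y = y * h"
    "f * y = y" "y * f = y"
    by (rule one_minus_sqrt[OF X(1) nX]) (use X in blast)
  \<comment> \<open>\<open>g\<close> is the absolute value of \<open>h\<close>: the square root of
    h^2, formed with \<open>f\<close> as unit.\<close>
  define g where "g = f - y"
  have g: "st g = g" "f * g = g" "g * f = g" "h * g = g * h"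
    by (simp_all add: g_def st_simps ff y h algebra_simps)
  have gg: "g * g = h * h"
  proof -
    have "g * g = f - (2 *\<^sub>R y - y * y)"
      by (simp add: g_def algebra_simps ff y(4-) scaleR_2)
    then show ?thesis by (simp add: y(3) X_def)
  qed
  define m where "m = (1/2) *\<^sub>R (g - h)"
  have m: "st m = m" "f * m = m" "m * f = m" "m * y = y * m"
    by (simp_all add: m_def st_simps g h algebra_simps y(4))
      (simp add: g_def algebra_simps y)
  have mm: "m * m = (1/2) *\<^sub>R (h * h - g * h)"
    by (simp add: m_def algebra_simps gg g(4) flip: scaleR_add_left)
  have mh: "m * h = - (m * m)" and mg: "m * g = m * m"
    unfolding mm by (simp_all add: m_def algebra_simps gg g(4))
  obtain z where z: "st z = z" "2 *\<^sub>R z - z * z = y" "m * z = z * m" "f * z = z" "z * f = z"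
    by (rule one_minus_sqrt[OF y(1,2)]) (use m y in blast)
  define d where "d = f - z"
  have d: "st d = d" "d * d = g" "m * d = d * m" "f * d = d" "d * f = d"
    by (simp_all add: d_def st_simps ff z algebra_simps m g_def scaleR_2 flip: z(2))
  \<comment> \<open>\<open>d\<close> is the square root of |h|, and m |h| = m^2, so \<open>t\<close>
    is m^(3/2).\<close>
  define t where "t = m * d"
  have t: "st t = t" "f * t = t" "t * f = t"
    by (simp_all add: t_def st_simps d m mult.assoc) (simp add: d flip: mult.assoc)
  have "t * t = m * (d * m) * d" by (simp add: t_def mult.assoc)
  also have "d * m = m * d" by (simp only: d(3))
  finally have tt: "t * t = m * (m * m)" by (simp add: mult.assoc d(2) mg)
  define v where "v = m * k"
  have "v * st v = m * h * m" by (simp add: v_def h_def st_simps m mult.assoc)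
  then have vv: "v * st v = - (t * t)" by (simp add: mh tt mult.assoc)
  define r where "r = t * v"
  have "r * st r = t * (v * st v) * t" by (simp add: r_def st_simps t mult.assoc)
  then have rr: "r * st r = - (t * t * (t * t))" by (simp add: vv mult.assoc)
  have "(st v * v) * (st v * v) = st v * (v * st v) * v" by (simp add: mult.assoc)
  then have nn: "(st v * v) * (st v * v) = - (st r * r)"
    unfolding vv by (simp add: r_def st_simps t mult.assoc)
  \<comment> \<open>By \<open>rr\<close> and \<open>nn\<close> the last two terms cancel and - t^4
    remains, so t^2 vanishes by the preceding criterion for - x^2.\<close>
  have "npos ((r * st r + st r * r) + (st v * v) * (st v * v))"
    by (intro npos_add npos_mult_st_add_st_mult npos_square) (simp add: st_simps)
  then have "npos (- ((t * t) * (t * t)))" by (simp add: rr nn)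
  moreover have "f * (t * t) = t * t" by (simp add: t flip: mult.assoc)
  moreover have "(t * t) * f = t * t" by (simp add: t mult.assoc)
  ultimately have "t * t = 0"
    using t by (intro selfadj_eq_0_if_npos_minus_square[OF f]) (auto simp: st_simps)
  then have "(m * m) * (m * m) = 0" by (simp add: tt mult.assoc)
  then have "m = 0"
    using m selfadj_square_eq_0[of "m * m"] selfadj_square_eq_0[of m] by (simp add: st_simps)
  \<comment> \<open>Without negative part, f - h equals \<open>y\<close>, whose norm is at most 1 by
    construction.\<close>
  then have "g = h" by (simp add: m_def)
  then have "f - h = y" by (simp add: g_def algebra_simps)
  then show ?thesis using y(2) by (simp add: h_def)
qed

text \<open>The fixed point of the contraction z \<mapsto> f + u z is the sum of the Neumann series.
  It is self-adjoint because its adjoint is a left inverse of f - u, and left and right inverses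
  agree.\<close>

lemma corner_inverse:
  assumes f: "cproj st f" and u: "st u = u" "f * u = u" "norm u < 1"
  obtains z where "st z = z" "f * z = z" "(f - u) * z = f"
proof -
  have ff: "st f = f" "f * f = f" using f by (auto simp: cproj_def)
  have "\<exists>!z\<in>UNIV. f + u * z = z"
    by (rule Banach_fix[where c = "norm u"])
      (auto simp: complete_UNIV u(3) dist_norm norm_mult_ineq simp flip: right_diff_distrib)
  then obtain z where z: "f + u * z = z" by blast
  have fz: "f * z = z"
    by (subst (1 2) z[symmetric]) (simp add: algebra_simps ff, metis u(2) mult.assoc)
  have inv: "(f - u) * z = f" using z by (simp add: algebra_simps fz)
  have "st z * (f - u) = f"
    using arg_cong[OF inv, of st] by (simp add: st_simps ff u)
  then have "st z * ((f - u) * z) = f * z" by (simp flip: mult.assoc)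
  moreover have "st z * f = st z" using arg_cong[OF fz, of st] by (simp add: st_simps ff)
  ultimately have "st z = z" by (simp add: inv fz)
  with fz inv that show thesis by blast
qed

text \<open>The coisometry v of the polar decomposition is the inverse square root of w w* times w;
w w* is invertible in the corner of f because f = w z z* w* is at most a multiple of it.\<close>
lemma right_invertible_polar:
  assumes f: "cproj st f" and w: "f * w = w" "w * z = f"
  obtains v where "v * st v = f" "f * v = v" "w * (st v * v) = w"
proof -
  have ff: "st f = f" "f * f = f" using f by (auto simp: cproj_def)
  have wf: "st w * f = st w" using arg_cong[OF w(1), of st] by (simp add: st_simps ff)
  \<comment> \<open>\<open>M\<close> exceeds |z|^2, so 1 - z z* / M has a square root 1 - y. With k
    = w (1 - y) this gives w w* - f / M = k k*, a lower bound for w w* in factored form.\<close>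
  define M where "M = (norm z)\<^sup>2 + 1"
  have M: "M > 0" by (simp add: M_def add_nonneg_pos)
  define x where "x = (1 / M) *\<^sub>R (z * st z)"
  have x: "st x = x" "norm x \<le> 1"
    using M by (simp_all add: x_def st_simps norm_mult_st) (simp add: M_def)
  obtain y where y: "st y = y" "2 *\<^sub>R y - y * y = x"
    by (rule one_minus_sqrt[OF x])
  define k where "k = w - w * y"
  have "k * st k = w * st w - w * (2 *\<^sub>R y - y * y) * st w"
    by (simp add: k_def st_simps y(1) algebra_simps scaleR_2)
  also have "w * (2 *\<^sub>R y - y * y) * st w = (1 / M) *\<^sub>R (w * z * st (w * z))"
    by (simp add: y x_def st_simps mult.assoc)
  finally have kk: "k * st k = w * st w - (1 / M) *\<^sub>R f"
    by (simp add: w ff)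
  have fk: "f * k = k" by (simp add: k_def algebra_simps w(1)) (simp add: w(1) flip: mult.assoc)
  \<comment> \<open>\<open>s\<close> makes k / s a contraction, so f - k k* / s^2 has norm at most
    1; \<open>N\<close> is chosen so that f - w w* / N is s^2 / N < 1 times that element.\<close>
  define s where "s = norm k + 1"
  have s: "s > 0" by (simp add: s_def add_nonneg_pos)
  have nk: "norm (f - (1 / s\<^sup>2) *\<^sub>R (k * st k)) \<le> 1"
    using norm_proj_minus_mult_st_le_1[OF f, of "(1 / s) *\<^sub>R k"] fk s
    by (simp add: st_simps power2_eq_square) (simp add: s_def)
  define N where "N = s\<^sup>2 + 1 / M"
  have N: "N > 0" "s\<^sup>2 / N < 1" using s M by (simp_all add: N_def add_pos_pos)
  define u where "u = f - (1 / N) *\<^sub>R (w * st w)"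
  have "u = (s\<^sup>2 / N) *\<^sub>R (f - (1 / s\<^sup>2) *\<^sub>R (k * st k))"
  proof -
    have "N *\<^sub>R u = N *\<^sub>R f - w * st w" using N by (simp add: u_def algebra_simps)
    also have "\<dots> = s\<^sup>2 *\<^sub>R (f - (1 / s\<^sup>2) *\<^sub>R (k * st k))"
      using s by (simp add: kk N_def algebra_simps)
    finally have "(1 / N) *\<^sub>R N *\<^sub>R u = (1 / N) *\<^sub>R s\<^sup>2 *\<^sub>R (f - (1 / s\<^sup>2) *\<^sub>R (k * st k))" by simp
    then show ?thesis using N by simp
  qed
  then have "norm u \<le> s\<^sup>2 / N * 1"
    using nk s N by (simp del: mult_1_right add: mult_left_mono divide_right_mono)
  then have nu: "norm u < 1" using N(2) by linarith
  have u: "st u = u" "f * u = u" "u * f = u"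
    by (simp_all add: u_def st_simps ff algebra_simps w wf) (simp add: w flip: mult.assoc)
  obtain a where a: "st a = a" "f * a = a" "(f - u) * a = f"
    using corner_inverse[OF f u(1,2) nu] .
  have a': "a * (f - u) = f"
    using arg_cong[OF a(3), of st] by (simp add: st_simps ff a(1) u(1))
  have nu': "norm u \<le> 1" using nu by simp
  obtain c where c: "st c = c" "2 *\<^sub>R c - c * c = u" "\<And>x. x * u = u * x \<Longrightarrow> x * c = c * x"
    "f * c = c" "c * f = c"
    by (rule one_minus_sqrt[OF u(1) nu']) (use u in blast)
  define d where "d = f - c"
  have d: "st d = d" "f * d = d" "d * f = d" by (simp_all add: d_def st_simps ff c algebra_simps)
  have dd: "d * d = f - u"
    by (simp add: d_def algebra_simps ff c(4,5) scaleR_2 flip: c(2))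
  have "a * (f - u) = (f - u) * a" by (simp add: a a')
  moreover have af: "a * f = a" using arg_cong[OF a(2), of st] by (simp add: st_simps ff a(1))
  ultimately have "a * u = u * a" by (simp add: algebra_simps a)
  then have ad: "a * d = d * a" using c(3) by (simp add: d_def algebra_simps a af)
  \<comment> \<open>\<open>d\<close> is the square root of w w* / N, and \<open>d * a\<close> is its
    inverse in the corner.\<close>
  define v where "v = (1 / sqrt N) *\<^sub>R (d * a * w)"
  have ww: "w * st w = N *\<^sub>R (f - u)" using N by (simp add: u_def)
  have "v * st v = (1 / N) *\<^sub>R (d * a * (w * st w) * (a * d))"
    using N by (simp add: v_def st_simps d a mult.assoc)
  also have "\<dots> = d * (a * (f - u)) * a * d" using N by (simp add: ww mult.assoc)
  also have "\<dots> = d * d * a" by (simp add: a' d mult.assoc ad)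
  finally have vv: "v * st v = f" by (simp add: dd a)
  have fv: "f * v = v" by (simp add: v_def d flip: mult.assoc)
  have "w = (f - u) * a * w" by (simp add: a w)
  then have wv: "w = sqrt N *\<^sub>R (d * v)" using N by (simp add: v_def mult.assoc flip: dd)
  have "w * (st v * v) = sqrt N *\<^sub>R (d * (v * st v) * v)" by (subst wv) (simp add: mult.assoc)
  then have "w * (st v * v) = w" by (simp add: vv d flip: wv)
  with vv fv that show thesis by blast
qed

section \<open>Multipliers\<close>

text \<open>Without boundedness the operator norm in the closure hypothesis would be a junk value.
By the C*-identity, L is the pointwise supremum of the continuous maps b \<mapsto> R a * b with a in the
unit ball, so the Baire category theorem applies.\<close>
lemma double_centralizer_bounded_linear:
  fixes L R :: "'a \<Rightarrow> 'a"
  assumes dc: "double_centralizer L R"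
  shows "bounded_linear L"
proof -
  have RL: "R a * b = a * L b" for a b using dc by (auto simp: double_centralizer_def)
  have add: "L (x + y) = L x + L y" for x y
    by (rule eq_if_left_mult_eq) (simp add: algebra_simps flip: RL)
  have scale: "L (c *\<^sub>R x) = c *\<^sub>R L x" for c x
    by (rule eq_if_left_mult_eq) (simp flip: RL)
  define V where "V k = {b. \<forall>a. norm a \<le> 1 \<longrightarrow> norm (R a * b) \<le> real k}" for k :: nat
  have Veq: "V k = (\<Inter>a\<in>{a. norm a \<le> 1}. {b. norm (R a * b) \<le> real k})" for k
    by (auto simp: V_def)
  have clo: "closed (V k)" for k
    unfolding Veq by (intro closed_INT ballI closed_Collect_le continuous_intros)
  have "b \<in> (\<Union>k. V k)" for b
  proof -
    obtain k :: nat where k: "norm (L b) \<le> real k" using real_arch_simple by blast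
    have "norm (a * L b) \<le> real k" if "norm a \<le> 1" for a
      using norm_mult_ineq[of a "L b"] mult_right_mono[OF that, of "norm (L b)"] k by simp
    then show ?thesis by (auto simp: V_def RL)
  qed
  then have UV: "(\<Union>k. V k) = UNIV" by blast
  obtain k where k: "interior (V k) \<noteq> {}"
  proof (rule ccontr)
    assume "\<not> thesis"
    then have "interior (V k) = {}" for k using that by blast
    then have "euclidean interior_of \<Union>(range V) = {}"
      by (intro Baire_category_alt)
        (auto simp: completely_metrizable_space_euclidean clo)
    then show False using UV by simp
  qed
  then obtain c where "c \<in> interior (V k)" by blast
  then obtain e where e: "e > 0" "ball c e \<subseteq> V k" using mem_interior by blast
  have small: "norm (R a * b) \<le> 2 * real k" if "norm a \<le> 1" "norm b < e" for a b
  proof -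
    have "c + b \<in> V k" "c \<in> V k" using e that by (auto simp: dist_norm subset_iff)
    then have "norm (R a * (c + b)) \<le> real k" "norm (R a * c) \<le> real k"
      using that by (auto simp: V_def)
    moreover have "R a * b = R a * (c + b) - R a * c" by (simp add: algebra_simps)
    ultimately show ?thesis
      using norm_triangle_ineq4[of "R a * (c + b)" "R a * c"] by simp
  qed
  have "norm (L b) \<le> norm b * (4 * real k / e)" for b
  proof (cases "b = 0 \<or> L b = 0")
    case True
    moreover have "L 0 = 0" using scale[of 0 0] by simp
    ultimately show ?thesis using e by auto
  next
    case False
    \<comment> \<open>This \<open>a\<close> turns the bound on \<open>R a * b\<close> into a bound
      on the norm of \<open>L b\<close>, by the C*-identity.\<close>
    define a where "a = (1 / norm (L b)) *\<^sub>R st (L b)"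
    have a: "norm a \<le> 1" using False by (simp add: a_def norm_st)
    have "norm (R a * ((e / (2 * norm b)) *\<^sub>R b)) \<le> 2 * real k"
      by (rule small[OF a]) (use False e in simp)
    moreover have "norm (R a * b) = norm (L b)"
      using False by (simp add: RL a_def cstar_id power2_eq_square)
    ultimately have "e / (2 * norm b) * norm (L b) \<le> 2 * real k" using e by simp
    then show ?thesis using e False by (simp add: field_simps)
  qed
  then show ?thesis
    by (intro bounded_linear_intro[where K = "4 * real k / e"] add scale)
qed

text \<open>For the multiplier T = (L, R) with inverse (L', R'), \<open>R f\<close> is f T and
  \<open>L' f\<close> is T^-1 f. Both lie in A, and their product is f.\<close>

lemma closure_multiplier_factor:
  fixes f t :: 'a
  assumes clo: "in_closure_invertible_multipliers TYPE('a)" and f: "cproj st f" and "\<epsilon> > 0"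
  obtains w z where "f * w = w" "w * z = f" "norm (f * t - w) \<le> \<epsilon>"
proof -
  have ff: "f * f = f" using f by (simp add: cproj_def)
  obtain L R where LR: "mult_invertible L R" "onorm (\<lambda>b. t * b - L b) < \<epsilon>"
    using clo \<open>\<epsilon> > 0\<close> unfolding in_closure_invertible_multipliers_def by blast
  then have dc: "double_centralizer L R" by (simp add: mult_invertible_def)
  obtain L' where L': "L \<circ> L' = id"
    using LR(1) by (auto simp: mult_invertible_def)
  have RL: "R a * b = a * L b" and R: "R (a * b) = a * R b" for a b
    using dc by (auto simp: double_centralizer_def)
  have bl: "bounded_linear (\<lambda>b. t * b - L b)"
    by (intro bounded_linear_sub bounded_linear_mult_right double_centralizer_bounded_linear[OF dc])
  have "norm ((f * t - R f) * b) \<le> \<epsilon> * norm b" for b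
  proof -
    have "(f * t - R f) * b = f * (t * b - L b)" by (simp add: algebra_simps RL)
    then have "norm ((f * t - R f) * b) \<le> 1 * norm (t * b - L b)"
      using norm_mult_ineq[of f "t * b - L b"]
        mult_right_mono[OF norm_proj_le_1[OF f], of "norm (t * b - L b)"] by simp
    also have "\<dots> \<le> \<epsilon> * norm b"
      using order_trans[OF onorm[OF bl, of b]
          mult_right_mono[OF less_imp_le[OF LR(2)] norm_ge_zero[of b]]] by simp
    finally show ?thesis .
  qed
  then have "norm (f * t - R f) \<le> \<epsilon>"
    by (rule norm_le_if_left_mult_le[OF _ less_imp_le[OF \<open>\<epsilon> > 0\<close>]])
  moreover have "f * R f = R f" using R[of f f] by (simp add: ff)
  moreover have "R f * L' f = f" using fun_cong[OF L', of f] by (simp add: RL ff)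
  ultimately show thesis using that by blast
qed

section \<open>Murray--von Neumann equivalence of matrices over A\<close>

definition mm :: "nat \<Rightarrow> (nat \<Rightarrow> nat \<Rightarrow> 'a) \<Rightarrow> (nat \<Rightarrow> nat \<Rightarrow> 'a) \<Rightarrow> nat \<Rightarrow> nat \<Rightarrow> 'a" where
  "mm N X Y = (\<lambda>i j. \<Sum>k<N. X i k * Y k j)"

definition madj :: "(nat \<Rightarrow> nat \<Rightarrow> 'a) \<Rightarrow> nat \<Rightarrow> nat \<Rightarrow> 'a" where
  "madj X = (\<lambda>i j. st (X j i))"

definition rsupp :: "nat \<Rightarrow> nat \<Rightarrow> (nat \<Rightarrow> nat \<Rightarrow> 'a) \<Rightarrow> bool" where
  "rsupp m n X \<longleftrightarrow> (\<forall>i j. m \<le> i \<or> n \<le> j \<longrightarrow> X i j = 0)"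

definition mproj :: "nat \<Rightarrow> (nat \<Rightarrow> nat \<Rightarrow> 'a) \<Rightarrow> bool" where
  "mproj n P \<longleftrightarrow> rsupp n n P \<and> madj P = P \<and> mm n P P = P"

text \<open>Separate row and column offsets, unlike in \<open>dsum\<close>, allow block sums of
  rectangular partial isometries.\<close>

definition bsum :: "nat \<Rightarrow> nat \<Rightarrow> (nat \<Rightarrow> nat \<Rightarrow> 'a) \<Rightarrow> (nat \<Rightarrow> nat \<Rightarrow> 'a) \<Rightarrow> nat \<Rightarrow> nat \<Rightarrow> 'a" where
  "bsum m n X Y = (\<lambda>i j. if i < m \<and> j < n then X i j
                         else if m \<le> i \<and> n \<le> j then Y (i - m) (j - n) else 0)"

definition unit11 :: "'a \<Rightarrow> nat \<Rightarrow> nat \<Rightarrow> 'a" where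
  "unit11 a = (\<lambda>i j. if i = 0 \<and> j = 0 then a else 0)"

text \<open>Unlike in mvn_A, the partial isometry is rectangular of the sizes of the two projections.\<close>
definition mveq :: "nat \<Rightarrow> (nat \<Rightarrow> nat \<Rightarrow> 'a) \<Rightarrow> nat \<Rightarrow> (nat \<Rightarrow> nat \<Rightarrow> 'a) \<Rightarrow> bool" where
  "mveq n P m Q \<longleftrightarrow> (\<exists>v. rsupp m n v \<and> mm m (madj v) v = P \<and> mm n v (madj v) = Q)"

lemma mm_assoc: "mm N (mm M X Y) Z = mm M X (mm N Y Z)"
proof (intro ext)
  fix i j
  have "mm N (mm M X Y) Z i j = (\<Sum>k<N. \<Sum>l<M. X i l * Y l k * Z k j)"
    by (simp add: mm_def sum_distrib_right)
  also have "\<dots> = (\<Sum>l<M. \<Sum>k<N. X i l * Y l k * Z k j)" by (rule sum.swap)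
  also have "\<dots> = mm M X (mm N Y Z) i j"
    by (simp add: mm_def sum_distrib_left mult.assoc)
  finally show "mm N (mm M X Y) Z i j = mm M X (mm N Y Z) i j" .
qed

lemma st_sum: "st (sum F S) = (\<Sum>k\<in>S. st (F k))"
  by (rule linear_sum[OF bounded_linear.linear[OF bounded_linear_st]])

lemma madj_mm: "madj (mm N X Y) = mm N (madj Y) (madj X)"
  by (simp add: madj_def mm_def st_sum st_mult)

lemma madj_madj: "madj (madj X) = X"
  by (simp add: madj_def st_st)

lemma rsupp_madj: "rsupp m n (madj X) \<longleftrightarrow> rsupp n m X"
  by (auto simp: rsupp_def madj_def st_zero) (metis st_st st_zero)+

lemma rsupp_mono: "rsupp m n X \<Longrightarrow> m \<le> m' \<Longrightarrow> n \<le> n' \<Longrightarrow> rsupp m' n' X"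
  by (auto simp: rsupp_def)

lemma rsupp_mm: "rsupp m l X \<Longrightarrow> rsupp l' n Y \<Longrightarrow> rsupp m n (mm N X Y)"
  by (auto simp: rsupp_def mm_def)

lemma mm_size_cong:
  assumes "rsupp a c Y" "rsupp b d Y"
  shows "mm a X Y = mm b X Y"
proof (intro ext)
  fix i j
  have "mm a X Y i j = (\<Sum>k<min a b. X i k * Y k j)"
    unfolding mm_def by (rule sum.mono_neutral_right) (use assms in \<open>auto simp: rsupp_def\<close>)
  also have "\<dots> = mm b X Y i j"
    unfolding mm_def by (rule sum.mono_neutral_left) (use assms in \<open>auto simp: rsupp_def\<close>)
  finally show "mm a X Y i j = mm b X Y i j" .
qed

lemma sum_lessThan_add:
  fixes F :: "nat \<Rightarrow> 'b::comm_monoid_add"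
  shows "sum F {..<m + n} = sum F {..<m} + (\<Sum>k<n. F (m + k))"
  by (induction n) (simp_all add: add.assoc)

lemma mm_bsum: "mm (b + b') (bsum a b X Y) (bsum b c X' Y') = bsum a c (mm b X X') (mm b' Y Y')"
  by (intro ext) (auto simp: mm_def sum_lessThan_add bsum_def)

lemma madj_bsum: "madj (bsum a b X Y) = bsum b a (madj X) (madj Y)"
  by (intro ext) (auto simp: madj_def bsum_def st_zero)

lemma rsupp_bsum: "rsupp m n Y \<Longrightarrow> rsupp (a + m) (b + n) (bsum a b X Y)"
  by (auto simp: rsupp_def bsum_def)

lemma bsum_assoc: "bsum (a + b) (a + b) (bsum a a X Y) Z = bsum a a X (bsum b b Y Z)"
  by (intro ext) (auto simp: bsum_def)

lemma mproj_bsum: "mproj n P \<Longrightarrow> mproj m Q \<Longrightarrow> mproj (n + m) (bsum n n P Q)"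
  by (simp add: mproj_def rsupp_bsum madj_bsum mm_bsum)

lemma mveq_refl: "mproj n P \<Longrightarrow> mveq n P n P"
  unfolding mproj_def mveq_def by (intro exI[of _ P]) auto

lemma mveq_sym: "mveq n P m Q \<Longrightarrow> mveq m Q n P"
  unfolding mveq_def by (metis madj_madj rsupp_madj)

text \<open>The product w v works because v* Q v = v* v v* v = P^2 and w Q w* = R^2.\<close>

lemma mveq_trans:
  assumes p: "mproj n P" and r: "mproj l R" and pq: "mveq n P m Q" and qr: "mveq m Q l R"
  shows "mveq n P l R"
proof -
  obtain v where v: "rsupp m n v" "mm m (madj v) v = P" "mm n v (madj v) = Q"
    using pq by (auto simp: mveq_def)
  obtain w where w: "rsupp l m w" "mm l (madj w) w = Q" "mm m w (madj w) = R"
    using qr by (auto simp: mveq_def)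
  have "mm l (madj (mm m w v)) (mm m w v) = mm m (madj v) (mm m (mm l (madj w) w) v)"
    by (simp add: madj_mm mm_assoc)
  also have "\<dots> = mm m (madj v) (mm m (mm n v (madj v)) v)" by (simp add: v w)
  also have "\<dots> = mm n (mm m (madj v) v) (mm m (madj v) v)" by (simp add: mm_assoc)
  finally have 1: "mm l (madj (mm m w v)) (mm m w v) = P" using p by (simp add: v mproj_def)
  have "mm n (mm m w v) (madj (mm m w v)) = mm m w (mm m (mm n v (madj v)) (madj w))"
    by (simp add: madj_mm mm_assoc)
  also have "\<dots> = mm m w (mm m (mm l (madj w) w) (madj w))" by (simp add: v w)
  also have "\<dots> = mm l (mm m w (madj w)) (mm m w (madj w))" by (simp add: mm_assoc)
  finally have 2: "mm n (mm m w v) (madj (mm m w v)) = R" using r by (simp add: w mproj_def)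
  from 1 2 show ?thesis unfolding mveq_def
    using rsupp_mm[OF w(1) v(1)] by blast
qed

lemma mveq_bsum:
  assumes "mveq n P n' P'" "mveq m Q m' Q'"
  shows "mveq (n + m) (bsum n n P Q) (n' + m') (bsum n' n' P' Q')"
proof -
  obtain v where v: "rsupp n' n v" "mm n' (madj v) v = P" "mm n v (madj v) = P'"
    using assms(1) by (auto simp: mveq_def)
  obtain w where w: "rsupp m' m w" "mm m' (madj w) w = Q" "mm m w (madj w) = Q'"
    using assms(2) by (auto simp: mveq_def)
  show ?thesis unfolding mveq_def
    using v w by (intro exI[of _ "bsum n' n v w"]) (simp add: madj_bsum mm_bsum rsupp_bsum)
qed

lemma mveq_bsum_commute:
  assumes P: "mproj n P" and Q: "mproj m Q"
  shows "mveq (n + m) (bsum n n P Q) (m + n) (bsum m m Q P)"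
proof -
  \<comment> \<open>\<open>v\<close> has the block rows (0, Q) and (P, 0).\<close>
  define v where "v = (\<lambda>i j. if i < m \<and> n \<le> j then Q i (j - n)
     else if m \<le> i \<and> j < n then P (i - m) j else 0)"
  have adj: "st (P i j) = P j i" "st (Q i j) = Q j i" for i j
    using P Q by (auto simp: mproj_def madj_def dest: fun_cong)
  have sq: "(\<Sum>k<n. P i k * P k j) = P i j" "(\<Sum>k<m. Q i k * Q k j) = Q i j" for i j
    using P Q by (auto simp: mproj_def mm_def dest: fun_cong)
  have z: "P i j = 0" if "n \<le> i \<or> n \<le> j" for i j using P that by (auto simp: mproj_def rsupp_def)
  have z': "Q i j = 0" if "m \<le> i \<or> m \<le> j" for i j using Q that by (auto simp: mproj_def rsupp_def)
  have "rsupp (m + n) (n + m) v"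
    using z z' by (auto simp: rsupp_def v_def)
  moreover have "mm (m + n) (madj v) v = bsum n n P Q"
    by (intro ext) (auto simp: mm_def madj_def sum_lessThan_add v_def bsum_def adj sq st_zero)
  moreover have "mm (n + m) v (madj v) = bsum m m Q P"
    by (intro ext) (auto simp: mm_def madj_def sum_lessThan_add v_def bsum_def adj sq st_zero)
  ultimately show ?thesis unfolding mveq_def by blast
qed

text \<open>Block sums are strictly associative, so it suffices to swap the middle blocks E and
  Q.\<close>

lemma mveq_bsum_interchange:
  assumes P: "mproj a P" "mproj b E" "mproj c Q" "mproj d F"
  shows "mveq ((a + b) + (c + d)) (bsum (a + b) (a + b) (bsum a a P E) (bsum c c Q F))
              ((a + c) + (b + d)) (bsum (a + c) (a + c) (bsum a a P Q) (bsum b b E F))"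
proof -
  have "mveq (a + ((b + c) + d)) (bsum a a P (bsum (b + c) (b + c) (bsum b b E Q) F))
             (a + ((c + b) + d)) (bsum a a P (bsum (c + b) (c + b) (bsum c c Q E) F))"
    using P by (intro mveq_bsum mveq_refl mveq_bsum_commute)
  then show ?thesis by (simp only: bsum_assoc add.assoc)
qed

lemma mproj_unit11: "cproj st p \<Longrightarrow> mproj 1 (unit11 p)"
  by (auto simp: mproj_def rsupp_def unit11_def madj_def mm_def cproj_def st_zero fun_eq_iff)

lemma mveq_unit11: "mveq 1 (unit11 (st v * v)) 1 (unit11 (v * st v))"
  unfolding mveq_def
  by (intro exI[of _ "unit11 v"])
    (auto simp: rsupp_def unit11_def madj_def mm_def st_zero fun_eq_iff)

text \<open>The 1 by 1 zero matrix is equivalent to the empty one. Hence p = 0 competes in every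
  singular value, and no infimum is over the empty set.\<close>

lemma mveq_zero_bsum:
  assumes "mproj n P"
  shows "mveq n P (1 + n) (bsum 1 1 (unit11 0) P)"
proof -
  have "mveq 1 (unit11 0) 0 (\<lambda>_ _. 0)"
    unfolding mveq_def
    by (intro exI[of _ "\<lambda>_ _. 0"]) (auto simp: rsupp_def mm_def unit11_def madj_def)
  from mveq_bsum[OF this mveq_refl[OF assms]]
  have "mveq (1 + n) (bsum 1 1 (unit11 0) P) n P" by (simp add: bsum_def)
  then show ?thesis by (rule mveq_sym)
qed

section \<open>Matrices over A inside matrices over the unitization\<close>

definition lift :: "(nat \<Rightarrow> nat \<Rightarrow> 'a) \<Rightarrow> 'a umat" where
  "lift X = (\<lambda>i j. (X i j, 0))"

lemma in_A_iff_lift: "in_A M \<longleftrightarrow> (\<exists>X. M = lift X)"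
proof
  assume "in_A M"
  then have "M = lift (\<lambda>i j. fst (M i j))"
    by (intro ext prod_eqI) (auto simp: in_A_def lift_def)
  then show "\<exists>X. M = lift X" by blast
qed (auto simp: in_A_def lift_def)

lemma lift_inject: "lift X = lift Y \<longleftrightarrow> X = Y"
  by (auto simp: lift_def fun_eq_iff)

lemma umm_lift: "umm sc N (lift X) (lift Y) = lift (mm N X Y)"
proof -
  have "(\<Sum>k\<in>S. (F k, 0)) = (sum F S, 0 :: complex)" for F :: "nat \<Rightarrow> 'a" and S
    by (induction S rule: infinite_finite_induct) (auto simp: zero_prod_def)
  then show ?thesis by (simp add: umm_def lift_def mm_def umult_def sc_0_left)
qed

lemma ustar_m_lift: "ustar_m st (lift X) = lift (madj X)"
  by (simp add: ustar_m_def ustar_def lift_def madj_def)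

lemma supp_in_lift: "supp_in n (lift X) \<longleftrightarrow> rsupp n n X"
  by (simp add: supp_in_def lift_def rsupp_def zero_prod_def)

lemma dsum_lift: "dsum n (lift X) (lift Y) = lift (bsum n n X Y)"
  by (intro ext) (simp add: dsum_def lift_def bsum_def zero_prod_def)

lemma single_lift: "single a = lift (unit11 a)"
  by (intro ext) (simp add: single_def lift_def unit11_def zero_prod_def)

lemma proj_A_lift: "proj_A sc st n (lift P) \<longleftrightarrow> mproj n P"
  using in_A_iff_lift
  by (auto simp: proj_A_def uproj_def mproj_def supp_in_lift ustar_m_lift umm_lift lift_inject)

lemma proj_A_iff: "proj_A sc st n p \<longleftrightarrow> (\<exists>P. p = lift P \<and> mproj n P)"
  using proj_A_lift in_A_iff_lift by (metis proj_A_def)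

text \<open>A partial isometry u in a large corner is cut down to v = u P = Q u, which is supported
  in the m by n block.\<close>

lemma mvn_A_lift_iff:
  assumes P: "mproj n P" and Q: "mproj m Q"
  shows "mvn_A sc st (lift P) (lift Q) \<longleftrightarrow> mveq n P m Q"
proof
  assume "mvn_A sc st (lift P) (lift Q)"
  then obtain N u where u: "rsupp N N u" "rsupp N N P" "rsupp N N Q"
    "mm N (madj u) u = P" "mm N u (madj u) = Q"
    unfolding mvn_A_def
    by (auto simp: in_A_iff_lift supp_in_lift umm_lift ustar_m_lift lift_inject)
  have P': "rsupp n n P" "madj P = P" "mm N P P = P"
    using P mm_size_cong[of N N P n n P] u by (auto simp: mproj_def)
  have Q': "rsupp m m Q" "mm N Q Q = Q"
    using Q mm_size_cong[of N N Q m m Q] u by (auto simp: mproj_def)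
  define v where "v = mm N u P"
  have vQ: "v = mm N Q u" by (simp add: v_def mm_assoc flip: u(4,5))
  have vmn: "rsupp m n v"
    using rsupp_mm[OF u(1) P'(1), of N] rsupp_mm[OF Q'(1) u(1), of N]
    by (auto simp: rsupp_def simp flip: v_def vQ)
  have vN: "rsupp N N v" unfolding v_def by (intro rsupp_mm[OF u(1,2)])
  have "mm m (madj v) v = mm N (madj v) v" by (rule mm_size_cong[OF vmn vN])
  also have "\<dots> = mm N P (mm N (mm N (madj u) u) P)"
    by (simp add: v_def madj_mm P' mm_assoc)
  finally have 1: "mm m (madj v) v = P" by (simp add: u P')
  have "mm n v (madj v) = mm N v (madj v)"
    using vmn vN by (intro mm_size_cong[of _ m _ _ N]) (simp_all add: rsupp_madj)
  also have "\<dots> = mm N (mm N u (mm N P P)) (madj u)"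
    by (simp add: v_def madj_mm P'(2) mm_assoc)
  also have "\<dots> = mm N v (madj u)" by (simp add: P' v_def)
  also have "\<dots> = mm N Q (mm N u (madj u))" by (simp add: vQ mm_assoc)
  finally have 2: "mm n v (madj v) = Q" by (simp add: u Q')
  from 1 2 vmn show "mveq n P m Q" unfolding mveq_def by blast
next
  assume "mveq n P m Q"
  then obtain v where v: "rsupp m n v" "mm m (madj v) v = P" "mm n v (madj v) = Q"
    by (auto simp: mveq_def)
  define N where "N = max m n"
  have vN: "rsupp N N v" using rsupp_mono[OF v(1)] by (simp add: N_def)
  have "mm N (madj v) v = P" using mm_size_cong[OF vN v(1)] v(2) by simp
  moreover have "mm N v (madj v) = Q"
    using mm_size_cong[of N N "madj v" n m] vN v(1,3) by (simp add: rsupp_madj)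
  moreover have "rsupp N N P" "rsupp N N Q"
    using P Q by (auto simp: mproj_def N_def elim: rsupp_mono)
  ultimately show "mvn_A sc st (lift P) (lift Q)"
    unfolding mvn_A_def using vN
    by (intro exI[of _ N] exI[of _ "lift v"])
      (auto simp: in_A_iff_lift supp_in_lift umm_lift ustar_m_lift)
qed

section \<open>Subadditivity of the singular values\<close>

lemma approximate_join:
  fixes a b :: 'a
  assumes clo: "in_closure_invertible_multipliers TYPE('a)"
    and p: "cproj st p" and q: "cproj st q" and f: "cproj st f"
    and eq: "mveq (1 + 1) (bsum 1 1 (unit11 p) (unit11 q)) 1 (unit11 f)" and "\<epsilon> > 0"
  obtains e where "cproj st e" "mveq 1 (unit11 f) 1 (unit11 e)"
    "norm ((a + b) - (a + b) * e) \<le> norm (a - a * p) + norm (b - b * q) + \<epsilon>"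
proof -
  have pp: "p * p = p" "q * q = q" using p q by (auto simp: cproj_def)
  obtain v where v: "mm 1 (madj v) v = bsum 1 1 (unit11 p) (unit11 q)"
     "mm (1 + 1) v (madj v) = unit11 f"
    using eq by (auto simp: mveq_def)
  \<comment> \<open>\<open>v\<close> is a row of two partial isometries with initial projections
    \<open>p\<close> and \<open>q\<close> and orthogonal ranges adding up to
    \<open>f\<close>.\<close>
  define x y where "x = v 0 0" and "y = v 0 1"
  have xx: "st x * x = p" and yy: "st y * y = q" and xy: "st x * y = 0" and yx: "st y * x = 0"
    using fun_cong[OF fun_cong[OF v(1), of 0], of 0] fun_cong[OF fun_cong[OF v(1), of 0], of 1]
      fun_cong[OF fun_cong[OF v(1), of 1], of 0] fun_cong[OF fun_cong[OF v(1), of 1], of 1]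
    by (auto simp: x_def y_def mm_def madj_def bsum_def unit11_def)
  have fxy: "f = x * st x + y * st y"
    using fun_cong[OF fun_cong[OF v(2), of 0], of 0]
    by (auto simp: x_def y_def mm_def madj_def unit11_def numeral_2_eq_2)
  define s t where "s = a * st x + b * st y" and "t = x + y"
  have sx: "s * x = a * p" and sy: "s * y = b * q"
    by (simp_all add: s_def algebra_simps xx yy xy yx)
  have "f * t = x * p + y * q"
    by (simp add: t_def fxy algebra_simps xx yy xy yx)
  then have "s * (f * t) = (s * x) * p + (s * y) * q"
    by (simp add: algebra_simps)
  then have sft: "s * (f * t) = a * p + b * q"
    by (simp add: sx sy mult.assoc pp)
  \<comment> \<open>The approximation error gets multiplied by \<open>s\<close> on the left; the
    added 1 covers s = 0.\<close>
  define \<delta> where "\<delta> = \<epsilon> / (norm s + 1)"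
  have "\<delta> > 0" using \<open>\<epsilon> > 0\<close> by (simp add: \<delta>_def add_nonneg_pos)
  have "norm s * \<delta> \<le> (norm s + 1) * \<delta>" using \<open>\<delta> > 0\<close> by simp
  also have "\<dots> = \<epsilon>" using add_nonneg_pos[OF norm_ge_zero[of s] zero_less_one] by (simp add: \<delta>_def)
  finally have s\<delta>: "norm s * \<delta> \<le> \<epsilon>" .
  obtain w z where w: "f * w = w" "w * z = f" "norm (f * t - w) \<le> \<delta>"
    using closure_multiplier_factor[OF clo f \<open>\<delta> > 0\<close>] .
  obtain u where u: "u * st u = f" "f * u = u" "w * (st u * u) = w"
    using right_invertible_polar[OF f w(1,2)] .
  define e where "e = st u * u"
  have "e * e = st u * ((u * st u) * u)" by (simp add: e_def mult.assoc)
  then have e: "cproj st e"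
    by (simp add: cproj_def u) (simp add: e_def st_simps)
  have eqe: "mveq 1 (unit11 f) 1 (unit11 e)"
    using mveq_sym[OF mveq_unit11[of u]] by (simp add: u(1) e_def)
  \<comment> \<open>Since \<open>w * e = w\<close>, the term \<open>s * w\<close> is killed by 1 -
    e; only these three errors remain, and 1 - e does not enlarge them.\<close>
  define A B C where "A = a - a * p" and "B = b - b * q" and "C = s * (f * t - w)"
  have "a + b = A + B + C + s * w"
    by (simp add: A_def B_def C_def algebra_simps sft)
  then have "(a + b) - (a + b) * e = (A - A * e) + (B - B * e) + (C - C * e)"
    using u(3) by (simp add: algebra_simps flip: e_def)
  then have "norm ((a + b) - (a + b) * e) \<le> norm (A - A * e) + norm (B - B * e) + norm (C - C * e)"
    by (metis norm_triangle_ineq norm_triangle_le add_mono order_refl)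
  also have "\<dots> \<le> norm A + norm B + norm C"
    by (intro add_mono norm_proj_complement[OF e])
  also have "norm C \<le> \<epsilon>"
    using norm_mult_ineq[of s "f * t - w"] mult_left_mono[OF w(3), of "norm s"] s\<delta>
    by (simp add: C_def)
  finally have "norm ((a + b) - (a + b) * e) \<le> norm (a - a * p) + norm (b - b * q) + \<epsilon>"
    by (simp add: A_def B_def)
  with e eqe that show thesis by blast
qed

end

theorem theorem3p14:
  fixes sc :: "complex \<Rightarrow> 'a::{real_normed_algebra,banach} \<Rightarrow> 'a"
    and st :: "'a \<Rightarrow> 'a"
  assumes cstar: "cstar_algebra sc st"
    and cancellation: "\<And>n p m q. proj_A sc st n p \<Longrightarrow> proj_A sc st m q \<Longrightarrow>
                          (k0_eq sc st (n, p) (m, q) \<longleftrightarrow> mvn_A sc st p q)"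
    and closure: "in_closure_invertible_multipliers TYPE('a)"
    and K0plus_eq_D0: "\<And>n q. proj_A sc st n q \<Longrightarrow>
                          (\<exists>p. cproj st p \<and> k0_eq sc st (n, q) (1, single p))"
    and g: "proj_A sc st n q" and h: "proj_A sc st m r"
  shows "sval sc st (k0_add (n, q) (m, r)) (a + b) \<le> sval sc st (n, q) a + sval sc st (m, r) b"
proof -
  interpret cstar_algebra sc st by (rule cstar)
  have k0_eq_iff: "k0_eq sc st (n, lift P) (m, lift Q) \<longleftrightarrow> mveq n P m Q"
    if "mproj n P" "mproj m Q" for n P m Q
    using cancellation[of n "lift P" m "lift Q"] that by (simp add: proj_A_lift mvn_A_lift_iff)
  have k0_le_iff: "k0_le sc st (1, single p) (n, lift Q) \<longleftrightarrow>
      (\<exists>k E. mproj k E \<and> mveq n Q (1 + k) (bsum 1 1 (unit11 p) E))"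
    if "mproj n Q" "cproj st p" for n Q p
  proof -
    have "k0_eq sc st (n, lift Q) (k0_add (1, single p) (k, lift E)) \<longleftrightarrow>
        mveq n Q (1 + k) (bsum 1 1 (unit11 p) E)" if "mproj k E" for k E
      using k0_eq_iff[OF \<open>mproj n Q\<close> mproj_bsum[OF mproj_unit11[OF \<open>cproj st p\<close>] that]]
      by (simp add: k0_add_def single_lift dsum_lift)
    then show ?thesis
      unfolding k0_le_def proj_A_iff by blast
  qed
  define S where "S g x = {norm (x - x * p) | p. cproj st p \<and> k0_le sc st (1, single p) g}"
    for g :: "nat \<times> 'a umat" and x
  have sval: "sval sc st g x = Inf (S g x)" for g x by (simp add: sval_def S_def)
  have bdd: "bdd_below (S g x)" for g x by (rule bdd_belowI[of _ 0]) (auto simp: S_def)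
  have ne: "S (n, lift Q) x \<noteq> {}" if "mproj n Q" for n Q x
  proof -
    have "cproj st 0" by (simp add: cproj_def st_zero)
    then have "k0_le sc st (1, single 0) (n, lift Q)"
      using k0_le_iff[OF that] mveq_zero_bsum[OF that] that by blast
    with \<open>cproj st 0\<close> show ?thesis by (auto simp: S_def)
  qed
  obtain Q where Q: "q = lift Q" "mproj n Q" using g by (auto simp: proj_A_iff)
  obtain R where R: "r = lift R" "mproj m R" using h by (auto simp: proj_A_iff)
  have QR: "k0_add (n, q) (m, r) = (n + m, lift (bsum n n Q R))"
    by (simp add: k0_add_def Q R dsum_lift)
  \<comment> \<open>Here \<open>x\<close> and \<open>y\<close> are arbitrary competitors; the
    \<epsilon> comes only from the approximation by an invertible multiplier.\<close>
  have key: "Inf (S (n + m, lift (bsum n n Q R)) (a + b)) \<le> x + y"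
    if x: "x \<in> S (n, q) a" and y: "y \<in> S (m, r) b" for x y
  proof (rule field_le_epsilon)
    fix \<epsilon> :: real
    assume "\<epsilon> > 0"
    obtain p k E where p: "x = norm (a - a * p)" "cproj st p" "mproj k E"
      "mveq n Q (1 + k) (bsum 1 1 (unit11 p) E)"
      using x k0_le_iff[OF Q(2)] unfolding S_def Q(1) by blast
    obtain p' k' E' where p': "y = norm (b - b * p')" "cproj st p'" "mproj k' E'"
      "mveq m R (1 + k') (bsum 1 1 (unit11 p') E')"
      using y k0_le_iff[OF R(2)] unfolding S_def R(1) by blast
    note u = mproj_unit11[OF p(2)] mproj_unit11[OF p'(2)]
    have pp': "mproj (1 + 1) (bsum 1 1 (unit11 p) (unit11 p'))"
      by (intro mproj_bsum u)
    \<comment> \<open>This is where K_0(A)^+ = D_0(A) compresses a 2 by 2 projection to one in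
      A.\<close>
    then obtain f where f: "cproj st f"
      "mveq (1 + 1) (bsum 1 1 (unit11 p) (unit11 p')) 1 (unit11 f)"
      using K0plus_eq_D0[of "1 + 1" "lift (bsum 1 1 (unit11 p) (unit11 p'))"]
        k0_eq_iff[OF pp' mproj_unit11]
      unfolding proj_A_lift single_lift by blast
    obtain e where e: "cproj st e" "mveq 1 (unit11 f) 1 (unit11 e)"
      "norm ((a + b) - (a + b) * e) \<le> norm (a - a * p) + norm (b - b * p') + \<epsilon>"
      using approximate_join[OF closure p(2) p'(2) f \<open>\<epsilon> > 0\<close>] .
    have ue: "mproj 1 (unit11 e)" by (rule mproj_unit11[OF e(1)])
    \<comment> \<open>E \<oplus> E' is the remainder witnessing [e] \<le> g + h: exchanging the
      middle blocks brings p and p' together, and then e replaces p \<oplus> p'.\<close>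
    have EE': "mproj (k + k') (bsum k k E E')" by (rule mproj_bsum[OF p(3) p'(3)])
    have QRp: "mproj (n + m) (bsum n n Q R)" by (rule mproj_bsum[OF Q(2) R(2)])
    have 1: "mveq (n + m) (bsum n n Q R) ((1 + k) + (1 + k'))
        (bsum (1 + k) (1 + k) (bsum 1 1 (unit11 p) E) (bsum 1 1 (unit11 p') E'))"
      by (rule mveq_bsum[OF p(4) p'(4)])
    have 2: "mveq ((1 + k) + (1 + k'))
        (bsum (1 + k) (1 + k) (bsum 1 1 (unit11 p) E) (bsum 1 1 (unit11 p') E'))
        ((1 + 1) + (k + k')) (bsum (1 + 1) (1 + 1) (bsum 1 1 (unit11 p) (unit11 p')) (bsum k k E E'))"
      by (rule mveq_bsum_interchange[OF u(1) p(3) u(2) p'(3)])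
    have "mveq (1 + 1) (bsum 1 1 (unit11 p) (unit11 p')) 1 (unit11 e)"
      by (rule mveq_trans[OF pp' ue f(2) e(2)])
    then have 3: "mveq ((1 + 1) + (k + k'))
        (bsum (1 + 1) (1 + 1) (bsum 1 1 (unit11 p) (unit11 p')) (bsum k k E E'))
        (1 + (k + k')) (bsum 1 1 (unit11 e) (bsum k k E E'))"
      by (rule mveq_bsum[OF _ mveq_refl[OF EE']])
    have "mveq (n + m) (bsum n n Q R) (1 + (k + k')) (bsum 1 1 (unit11 e) (bsum k k E E'))"
      by (rule mveq_trans[OF QRp mproj_bsum[OF ue EE']
            mveq_trans[OF QRp mproj_bsum[OF pp' EE'] 1 2] 3])
    then have "k0_le sc st (1, single e) (n + m, lift (bsum n n Q R))"
      using EE' k0_le_iff[OF QRp e(1)] by blast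
    then have "norm ((a + b) - (a + b) * e) \<in> S (n + m, lift (bsum n n Q R)) (a + b)"
      using e(1) unfolding S_def by blast
    from cInf_lower[OF this bdd] e(3)
    show "Inf (S (n + m, lift (bsum n n Q R)) (a + b)) \<le> x + y + \<epsilon>"
      by (simp add: p(1) p'(1))
  qed
  let ?s = "Inf (S (n + m, lift (bsum n n Q R)) (a + b))"
  have "?s - y \<le> Inf (S (n, q) a)" if "y \<in> S (m, r) b" for y
    using ne Q key[OF _ that] by (intro cInf_greatest) (auto simp: diff_le_eq)
  then have "?s - Inf (S (n, q) a) \<le> Inf (S (m, r) b)"
    using ne R by (intro cInf_greatest) (auto simp: algebra_simps)
  then show ?thesis by (simp add: sval QR)
qed

end
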